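(* Let $G$ be a finite simple graph, let $g,f:V(G)\rightarrow \mathbb{Z}^{+}$ be two functions with $g(x)\leq f(x)$ for each vertex $x\in V(G)$, and let $H$ be a subgraph of $G$. Then $G$ has all fractional $(g,f)$-factors including $H$ if and only if $$ g(S)+d_{G-S}(T)-f(T)\geq d_H(S)-e_H(S,T) $$ for all disjoint subsets $S$ and $T$ of $V(G)$.
   Context: Graphs are finite, undirected, without loops or multiple edges. $\mathbb{Z}^{+}$ denotes the positive integers and $N$ the nonnegative integers. For $x\in V(G)$, $d_G(x)$ is the degree of $x$ in $G$ and $E(x)$ is the set of edges of $G$ incident with $x$. For a subgraph $H$ of $G$ and $x\in V(G)$, $d_H(x)$ is the degree of $x$ in $H$ (taken as $0$ if $x\notin V(H)$). For any function $\varphi:V(G)\rightarrow N$ and $S\subseteq V(G)$, $\varphi(S)=\sum_{x\in S}\varphi(x)$ with $\varphi(\emptyset)=0$; in particular $d_G(S)=\sum_{x\in S}d_G(x)$, $d_H(S)=\sum_{x\in S}d_H(x)$, and $d_{G-S}(T)=\sum_{x\in T}d_{G-S}(x)$, where $G-S$ is the graph obtained from $G$ by deleting the vertices of $S$ and their incident edges. For disjoint $S,T\subseteq V(G)$, $e_H(S,T)$ is the number of edges of $H$ joining a vertex of $S$ to a vertex of $T$. For $r:V(G)\rightarrow N$, a fractional $r$-factor of $G$ is given by a function $h:E(G)\rightarrow[0,1]$ (its indicator function) with $\sum_{e\in E(x)}h(e)=r(x)$ for every $x\in V(G)$; the factor $F_h$ is the spanning subgraph with edge set $\{e\in E(G):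 h(e)>0\}$. $G$ has all fractional $(g,f)$-factors including $H$ if for every $r:V(G)\rightarrow N$ with $g(x)\leq r(x)\leq f(x)$ for each $x\in V(G)$, $G$ has a fractional $r$-factor whose indicator function $h$ satisfies $h(e)=1$ for every $e\in E(H)$. *)

theory Defs
  imports Complex_Main
begin

record 'a sgraph =
  verts :: "'a set"
  edges :: "'a set set"

definition simple_graph :: "'a sgraph \<Rightarrow> bool" where
  "simple_graph G \<longleftrightarrow> finite (verts G) \<and>
     (\<forall>e\<in>edges G. \<exists>u\<in>verts G. \<exists>v\<in>verts G. u \<noteq> v \<and> e = {u, v})"

definition subgraph_of :: "'a sgraph \<Rightarrow> 'a sgraph \<Rightarrow> bool" where
  "subgraph_of H G \<longleftrightarrow> simple_graph H \<and> verts H \<subseteq> verts G \<and> edges H \<subseteq> edges G"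

definition incident_edges :: "'a sgraph \<Rightarrow> 'a \<Rightarrow> 'a set set" where
  "incident_edges G x = {e \<in> edges G. x \<in> e}"

text \<open>For a simple graph the degree is \<open>0\<close> at every \<open>x\<close> outside the vertex set.\<close>

definition degree :: "'a sgraph \<Rightarrow> 'a \<Rightarrow> nat" where
  "degree G x = card (incident_edges G x)"

definition delete_verts :: "'a sgraph \<Rightarrow> 'a set \<Rightarrow> 'a sgraph" where
  "delete_verts G S = \<lparr>verts = verts G - S, edges = {e \<in> edges G. e \<inter> S = {}}\<rparr>"

definition num_edges_between :: "'a sgraph \<Rightarrow> 'a set \<Rightarrow> 'a set \<Rightarrow> nat" where
  "num_edges_between H S T = card {e \<in> edges H. \<exists>s\<in>S. \<exists>t\<in>T. e = {s, t}}"

text \<open>A fractional \<open>r\<close>-factor is represented by its indicator function \<open>h\<close>, of which only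
  the values on the edges of \<open>G\<close> matter.\<close>

definition fractional_factor :: "'a sgraph \<Rightarrow> ('a \<Rightarrow> nat) \<Rightarrow> ('a set \<Rightarrow> real) \<Rightarrow> bool" where
  "fractional_factor G r h \<longleftrightarrow>
     (\<forall>e\<in>edges G. 0 \<le> h e \<and> h e \<le> 1) \<and>
     (\<forall>x\<in>verts G. (\<Sum>e\<in>incident_edges G x. h e) = real (r x))"

definition all_fractional_factors_including ::
    "'a sgraph \<Rightarrow> ('a \<Rightarrow> nat) \<Rightarrow> ('a \<Rightarrow> nat) \<Rightarrow> 'a sgraph \<Rightarrow> bool" where
  "all_fractional_factors_including G g f H \<longleftrightarrow>
     (\<forall>r :: 'a \<Rightarrow> nat. (\<forall>x\<in>verts G. g x \<le> r x \<and> r x \<le> f x) \<longrightarrow>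
        (\<exists>h. fractional_factor G r h \<and> (\<forall>e\<in>edges H. h e = 1)))"

end

theory Submission
  imports Defs "HOL-Analysis.Function_Topology"
begin

text \<open>For sufficiency, fix \<open>r\<close> and let \<open>h\<close> minimise the sum of the squared defects
  \<open>y x = r x - (\<Sum>e\<ni>x. h e)\<close> over the compact cube of all \<open>h\<close> with values in \<open>[0,1]\<close> and
  \<open>h = 1\<close> on \<open>H\<close>. By minimality an edge \<open>uv\<close> outside \<open>H\<close> has \<open>h = 1\<close> if
  \<open>y u + y v > 0\<close>, and \<open>h = 0\<close> if \<open>y u + y v < 0\<close>. For \<open>S = {y < 0}\<close> and
  \<open>T = {y > 0}\<close> this gives
  \<open>r(S) + d_{G-S}(T) - r(T) = d_H(S) - e_H(S,T) + y(S) - y(T)\<close>, so the condition forces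
  \<open>y(S) \<ge> y(T)\<close>, that is, \<open>y = 0\<close>. For necessity, take \<open>r = g\<close> on \<open>S\<close> and \<open>r = f\<close>
  elsewhere.\<close>

section \<open>Splitting degree sums over two disjoint vertex sets\<close>

text \<open>The set counted by \<open>num_edges_between\<close>, kept as a set so that weights can
  be summed over it.\<close>

definition edges_between :: "'a sgraph \<Rightarrow> 'a set \<Rightarrow> 'a set \<Rightarrow> 'a set set" where
  "edges_between G S T = {e \<in> edges G. \<exists>s\<in>S. \<exists>t\<in>T. e = {s, t}}"

lemma edges_between_commute: "edges_between G S T = edges_between G T S"
proof -
  have "(\<exists>s\<in>S. \<exists>t\<in>T. e = {s, t}) \<longleftrightarrow> (\<exists>t\<in>T. \<exists>s\<in>S. e = {t, s})" for e
    by (auto simp: insert_commute)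
  then show ?thesis
    unfolding edges_between_def by simp
qed

lemma simple_graph_edgeE:
  assumes "simple_graph G" "e \<in> edges G"
  obtains u v where "u \<in> verts G" "v \<in> verts G" "u \<noteq> v" "e = {u, v}"
  using assms unfolding simple_graph_def by blast

lemma finite_edges:
  assumes "simple_graph G"
  shows "finite (edges G)"
proof (rule finite_subset)
  show "edges G \<subseteq> Pow (verts G)"
    using assms unfolding simple_graph_def by fastforce
  show "finite (Pow (verts G))"
    using assms unfolding simple_graph_def by simp
qed

lemma finite_incident_edges: "simple_graph G \<Longrightarrow> finite (incident_edges G x)"
  unfolding incident_edges_def by (simp add: finite_edges)

lemma incident_edges_delete_verts:
  "incident_edges (delete_verts G S) x = {e \<in> incident_edges G x. e \<inter> S = {}}"
  unfolding incident_edges_def delete_verts_def by auto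

text \<open>Since \<open>x\<close> in \<open>T\<close> lies outside \<open>S\<close>, an edge at
  \<open>x\<close> either avoids \<open>S\<close> or has its other end in \<open>S\<close>. The
  weight \<open>h\<close> gives expressions for r(T) and, with \<open>S\<close> and \<open>T\<close>
  exchanged, for r(S).\<close>

lemma sum_incident_edges_split:
  fixes w :: "'a set \<Rightarrow> real"
  assumes G: "simple_graph G" and T: "finite T" and disj: "S \<inter> T = {}"
  shows "(\<Sum>x\<in>T. \<Sum>e\<in>incident_edges G x. w e) =
    (\<Sum>x\<in>T. \<Sum>e\<in>incident_edges (delete_verts G S) x. w e) + (\<Sum>e\<in>edges_between G S T. w e)"
proof -
  let ?B = "\<lambda>x. {e \<in> edges_between G S T. x \<in> e}"
  have finB: "finite (edges_between G S T)"
    unfolding edges_between_def by (simp add: finite_edges[OF G])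
  have "(\<Sum>e\<in>incident_edges G x. w e) =
      (\<Sum>e\<in>incident_edges (delete_verts G S) x. w e) + (\<Sum>e\<in>?B x. w e)" if "x \<in> T" for x
  proof -
    have "x \<notin> S"
      using that disj by blast
    have "e \<in> incident_edges (delete_verts G S) x \<union> ?B x" if e: "e \<in> incident_edges G x" for e
    proof -
      have eG: "e \<in> edges G" and "x \<in> e"
        using e unfolding incident_edges_def by auto
      obtain u v where "e = {u, v}"
        using simple_graph_edgeE[OF G eG] by metis
      with \<open>x \<in> e\<close> obtain z where z: "e = {z, x}"
        by blast
      show ?thesis
      proof (cases "z \<in> S")
        case True
        then show ?thesis
          using z eG \<open>x \<in> T\<close> unfolding edges_between_def by blast
      next
        case False
        then show ?thesis
          using z e \<open>x \<notin> S\<close> unfolding incident_edges_delete_verts by blast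
      qed
    qed
    then have "incident_edges G x = incident_edges (delete_verts G S) x \<union> ?B x"
      unfolding incident_edges_delete_verts
      by (auto simp: edges_between_def incident_edges_def)
    moreover have "incident_edges (delete_verts G S) x \<inter> ?B x = {}"
      unfolding incident_edges_delete_verts edges_between_def by blast
    ultimately show ?thesis
      using finB finite_incident_edges[OF G, of x] by (simp add: sum.union_disjoint)
  qed
  then have "(\<Sum>x\<in>T. \<Sum>e\<in>incident_edges G x. w e) =
      (\<Sum>x\<in>T. \<Sum>e\<in>incident_edges (delete_verts G S) x. w e) + (\<Sum>x\<in>T. \<Sum>e\<in>?B x. w e)"
    by (simp add: sum.distrib)
  also have "(\<Sum>x\<in>T. \<Sum>e\<in>?B x. w e) = sum w (\<Union>x\<in>T. ?B x)"
  proof (rule sum.UNION_disjoint[symmetric])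
    \<comment> \<open>An edge between \<open>S\<close> and \<open>T\<close> has only one end in
      \<open>T\<close>, so no edge is counted twice.\<close>
    show "\<forall>i\<in>T. \<forall>j\<in>T. i \<noteq> j \<longrightarrow> ?B i \<inter> ?B j = {}"
      using disj unfolding edges_between_def by auto
  qed (use T finB in auto)
  also have "(\<Union>x\<in>T. ?B x) = edges_between G S T"
    unfolding edges_between_def by auto
  finally show ?thesis .
qed

text \<open>Used for \<open>H\<close> with \<open>S\<close> and \<open>T\<close> exchanged: it turns
  d_H(S) - e_H(S,T) into d_{H-T}(S).\<close>

lemma sum_degree_split:
  assumes G: "simple_graph G" and T: "finite T" and disj: "S \<inter> T = {}"
  shows "(\<Sum>x\<in>T. real (degree G x)) =
    (\<Sum>x\<in>T. real (degree (delete_verts G S) x)) + real (num_edges_between G S T)"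
  using sum_incident_edges_split[OF assms, of "\<lambda>_. 1"]
  by (simp add: degree_def num_edges_between_def edges_between_def)

text \<open>Writes the degree in H - T as a sum over edges of G - T, ready for termwise comparison
  with the sum of \<open>h\<close>.\<close>

lemma sum_incident_edges_indicator:
  assumes G: "simple_graph G" and H: "edges H \<subseteq> edges G"
  shows "(\<Sum>e\<in>incident_edges (delete_verts G T) x. of_bool (e \<in> edges H)) =
    real (degree (delete_verts H T) x)"
proof -
  have "incident_edges (delete_verts G T) x \<inter> {e. e \<in> edges H} =
      incident_edges (delete_verts H T) x"
    using H unfolding incident_edges_def delete_verts_def by auto
  moreover have "finite (incident_edges (delete_verts G T) x)"
    unfolding incident_edges_delete_verts by (simp add: finite_incident_edges[OF G])
  ultimately show ?thesis
    by (simp add: degree_def sum.If_cases of_bool_def)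
qed

section \<open>Weights of least squared defect\<close>

definition defect :: "'a sgraph \<Rightarrow> ('a \<Rightarrow> nat) \<Rightarrow> ('a set \<Rightarrow> real) \<Rightarrow> 'a \<Rightarrow> real" where
  "defect G r h x = real (r x) - (\<Sum>e\<in>incident_edges G x. h e)"

text \<open>The product runs over all sets, not only over edges of \<open>G\<close>, so that its
  topology is that of the whole function type.\<close>

definition factor_cube :: "'a sgraph \<Rightarrow> ('a set \<Rightarrow> real) set" where
  "factor_cube H = PiE UNIV (\<lambda>e. if e \<in> edges H then {1} else {0..1})"

lemma factor_cube_iff:
  "h \<in> factor_cube H \<longleftrightarrow> (\<forall>e. 0 \<le> h e \<and> h e \<le> 1) \<and> (\<forall>e\<in>edges H. h e = 1)"
proof -
  have "h e \<in> (if e \<in> edges H then {1} else {0..1}) \<longleftrightarrow>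
      (0 \<le> h e \<and> h e \<le> 1) \<and> (e \<in> edges H \<longrightarrow> h e = 1)" for e
    by auto
  then show ?thesis
    unfolding factor_cube_def PiE_iff by auto
qed

text \<open>Tychonoff: every factor is a point or the closed unit interval.\<close>

lemma compact_factor_cube: "compact (factor_cube H)"
proof -
  have "compactin (product_topology (\<lambda>_. euclidean) UNIV) (factor_cube H)"
    unfolding factor_cube_def by (subst compactin_PiE) auto
  then show ?thesis
    by (simp add: euclidean_product_topology)
qed

lemma defect_minimiser_exists:
  obtains h where "h \<in> factor_cube H"
    "\<And>h'. h' \<in> factor_cube H \<Longrightarrow>
      (\<Sum>x\<in>verts G. (defect G r h x)\<^sup>2) \<le> (\<Sum>x\<in>verts G. (defect G r h' x)\<^sup>2)"
proof -
  have coord: "continuous_on (factor_cube H) (\<lambda>h. h e)" for e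
    by (rule continuous_on_subset[OF continuous_on_product_coordinates]) simp
  have "continuous_on (factor_cube H) (\<lambda>h. \<Sum>x\<in>verts G. (defect G r h x)\<^sup>2)"
    unfolding defect_def by (intro continuous_intros coord)
  moreover have "(\<lambda>_. 1) \<in> factor_cube H"
    unfolding factor_cube_iff by simp
  ultimately show thesis
    using continuous_attains_inf[OF compact_factor_cube] that by blast
qed

lemma defect_update:
  assumes "simple_graph G" "e \<in> edges G"
  shows "defect G r (h(e := h e + t)) x = defect G r h x - (if x \<in> e then t else 0)"
proof -
  have fin: "finite (incident_edges G x)"
    by (rule finite_incident_edges[OF assms(1)])
  have "(\<Sum>e'\<in>incident_edges G x. (h(e := h e + t)) e') =
      (\<Sum>e'\<in>incident_edges G x. h e' + (if e' = e then t else 0))"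
    by (rule sum.cong) auto
  also have "\<dots> = (\<Sum>e'\<in>incident_edges G x. h e') + (if x \<in> e then t else 0)"
    using fin assms(2) by (simp add: sum.distrib incident_edges_def)
  finally show ?thesis
    unfolding defect_def by simp
qed

text \<open>Adding \<open>t\<close> to the weight of \<open>{u, v}\<close> lowers the defects at
  \<open>u\<close> and \<open>v\<close> by \<open>t\<close>. With \<open>c\<close> the sum of these
  two defects, the objective changes by 2t^2 - 2tc, which minimality makes nonnegative.\<close>

lemma defect_minimiser_variation:
  assumes G: "simple_graph G" and e: "{u, v} \<in> edges G" "{u, v} \<notin> edges H"
    and uv: "u \<in> verts G" "v \<in> verts G" "u \<noteq> v"
    and h: "h \<in> factor_cube H"
    and min: "\<And>h'. h' \<in> factor_cube H \<Longrightarrow>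
      (\<Sum>x\<in>verts G. (defect G r h x)\<^sup>2) \<le> (\<Sum>x\<in>verts G. (defect G r h' x)\<^sup>2)"
    and t: "0 \<le> h {u, v} + t" "h {u, v} + t \<le> 1"
  shows "t * (defect G r h u + defect G r h v) \<le> t\<^sup>2"
proof -
  let ?h = "h({u, v} := h {u, v} + t)" and ?y = "defect G r h"
  have fin: "finite (verts G)"
    using G unfolding simple_graph_def by blast
  have "?h \<in> factor_cube H"
    using h t e(2) unfolding factor_cube_iff by auto
  then have "(\<Sum>x\<in>verts G. (?y x)\<^sup>2) \<le> (\<Sum>x\<in>verts G. (defect G r ?h x)\<^sup>2)"
    by (rule min)
  also have "\<dots> = (\<Sum>x\<in>verts G. (?y x)\<^sup>2 + (if x \<in> {u, v} then t\<^sup>2 - 2 * t * ?y x else 0))"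
    unfolding defect_update[OF G e(1)] by (rule sum.cong) (auto simp: power2_diff)
  also have "\<dots> = (\<Sum>x\<in>verts G. (?y x)\<^sup>2) + (\<Sum>x\<in>verts G \<inter> {u, v}. t\<^sup>2 - 2 * t * ?y x)"
    unfolding sum.distrib sum.inter_restrict[OF fin] ..
  also have "verts G \<inter> {u, v} = {u, v}"
    using uv by blast
  finally show ?thesis
    using uv(3) by (simp add: algebra_simps)
qed

text \<open>First-order optimality: unless the weight already sits at the end of [0,1] towards which
  the sign of the defect sum points, a small move in that direction lowers the objective.\<close>

lemma defect_minimiser_edge:
  assumes G: "simple_graph G" and e: "{u, v} \<in> edges G" "{u, v} \<notin> edges H"
    and uv: "u \<in> verts G" "v \<in> verts G" "u \<noteq> v"
    and h: "h \<in> factor_cube H"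
    and min: "\<And>h'. h' \<in> factor_cube H \<Longrightarrow>
      (\<Sum>x\<in>verts G. (defect G r h x)\<^sup>2) \<le> (\<Sum>x\<in>verts G. (defect G r h' x)\<^sup>2)"
  shows "defect G r h u + defect G r h v > 0 \<Longrightarrow> h {u, v} = 1"
    and "defect G r h u + defect G r h v < 0 \<Longrightarrow> h {u, v} = 0"
proof -
  let ?c = "defect G r h u + defect G r h v"
  note var = defect_minimiser_variation[OF G e uv h min]
  have bounds: "0 \<le> h {u, v}" "h {u, v} \<le> 1"
    using h unfolding factor_cube_iff by auto
  show "h {u, v} = 1" if c: "?c > 0"
  proof (rule ccontr)
    assume "h {u, v} \<noteq> 1"
    with bounds have "h {u, v} < 1"
      by simp
    \<comment> \<open>Halving \<open>?c\<close> keeps \<open>t\<close> strictly below it, so that t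
      * ?c > t * t; the other bound keeps the new weight at most 1.\<close>
    define t where "t = min (1 - h {u, v}) (?c / 2)"
    have "0 < t" "t < ?c" "h {u, v} + t \<le> 1"
      using c \<open>h {u, v} < 1\<close> unfolding t_def by (auto simp: min_def field_simps)
    moreover from this have "t * ?c \<le> t * t"
      using var[of t] bounds by (simp add: power2_eq_square)
    ultimately show False
      by simp
  qed
  show "h {u, v} = 0" if c: "?c < 0"
  proof (rule ccontr)
    assume "h {u, v} \<noteq> 0"
    with bounds have "0 < h {u, v}"
      by simp
    \<comment> \<open>Mirror image: now ?c < t < 0, and again t * ?c > t * t.\<close>
    define t where "t = max (- h {u, v}) (?c / 2)"
    have "t < 0" "?c < t" "0 \<le> h {u, v} + t"
      using c \<open>0 < h {u, v}\<close> unfolding t_def by (auto simp: max_def field_simps)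
    moreover from this have "t * ?c \<le> t * t"
      using var[of t] bounds by (simp add: power2_eq_square)
    ultimately show False
      by simp
  qed
qed

section \<open>Sufficiency for a single \<open>r\<close>\<close>

text \<open>The hypothesis \<open>cond\<close> is the inequality of the theorem with both
  \<open>g\<close> and \<open>f\<close> replaced by \<open>r\<close>.\<close>

lemma fractional_factor_including_exists:
  fixes r :: "'a \<Rightarrow> nat"
  assumes G: "simple_graph G" and HG: "subgraph_of H G"
    and cond: "\<And>S T. S \<subseteq> verts G \<Longrightarrow> T \<subseteq> verts G \<Longrightarrow> S \<inter> T = {} \<Longrightarrow>
      (\<Sum>x\<in>S. real (degree H x)) - real (num_edges_between H S T) \<le>
      (\<Sum>x\<in>S. real (r x)) + (\<Sum>x\<in>T. real (degree (delete_verts G S) x)) - (\<Sum>x\<in>T. real (r x))"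
  obtains h where "fractional_factor G r h" "\<forall>e\<in>edges H. h e = 1"
proof -
  have H: "simple_graph H" "edges H \<subseteq> edges G"
    using HG unfolding subgraph_of_def by auto
  have finV: "finite (verts G)"
    using G unfolding simple_graph_def by blast
  obtain h where h: "h \<in> factor_cube H" and min: "\<And>h'. h' \<in> factor_cube H \<Longrightarrow>
      (\<Sum>x\<in>verts G. (defect G r h x)\<^sup>2) \<le> (\<Sum>x\<in>verts G. (defect G r h' x)\<^sup>2)"
    using defect_minimiser_exists by blast
  define y where "y = defect G r h"
  define S T where "S = {x \<in> verts G. y x < 0}" and "T = {x \<in> verts G. y x > 0}"
  have ST: "S \<subseteq> verts G" "T \<subseteq> verts G" "S \<inter> T = {}" "T \<inter> S = {}"
    unfolding S_def T_def by auto
  have fin: "finite S" "finite T"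
    using ST finV finite_subset by blast+
  have h1: "h e = 1" if "e \<in> edges H" for e
    using h that unfolding factor_cube_iff by blast
  \<comment> \<open>Both ends of such an edge have defect at least 0, and \<open>x\<close> has
    positive defect, so the defect sum is positive.\<close>
  have hT: "h e = 1" if x: "x \<in> T" and e: "e \<in> incident_edges (delete_verts G S) x" for x e
  proof (cases "e \<in> edges H")
    case False
    have e': "e \<in> edges G" "x \<in> e" "e \<inter> S = {}"
      using e unfolding delete_verts_def incident_edges_def by auto
    obtain u v where uv: "u \<in> verts G" "v \<in> verts G" "u \<noteq> v" "e = {u, v}"
      using simple_graph_edgeE[OF G e'(1)] .
    have "u \<notin> S" "v \<notin> S" "u \<in> T \<or> v \<in> T"
      using e' x uv(4) by auto
    then have "y u + y v > 0"
      using uv(1,2) unfolding S_def T_def by auto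
    then show ?thesis
      using defect_minimiser_edge(1)[OF G _ _ uv(1-3) h min] uv(4) e'(1) False
      unfolding y_def by blast
  qed (rule h1)
  \<comment> \<open>Here the defect sum is negative, so \<open>h\<close> vanishes outside
    \<open>H\<close> and coincides with the indicator of \<open>H\<close>.\<close>
  have hS: "h e = of_bool (e \<in> edges H)"
    if x: "x \<in> S" and e: "e \<in> incident_edges (delete_verts G T) x" for x e
  proof (cases "e \<in> edges H")
    case False
    have e': "e \<in> edges G" "x \<in> e" "e \<inter> T = {}"
      using e unfolding delete_verts_def incident_edges_def by auto
    obtain u v where uv: "u \<in> verts G" "v \<in> verts G" "u \<noteq> v" "e = {u, v}"
      using simple_graph_edgeE[OF G e'(1)] .
    have "u \<notin> T" "v \<notin> T" "u \<in> S \<or> v \<in> S"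
      using e' x uv(4) by auto
    then have "y u + y v < 0"
      using uv(1,2) unfolding S_def T_def by auto
    then show ?thesis
      using defect_minimiser_edge(2)[OF G _ _ uv(1-3) h min] uv(4) e'(1) False
      unfolding y_def by simp
  qed (simp add: h1)
  have r_eq: "real (r x) = y x + (\<Sum>e\<in>incident_edges G x. h e)" for x
    unfolding y_def defect_def by simp
  have "(\<Sum>x\<in>T. \<Sum>e\<in>incident_edges (delete_verts G S) x. h e) =
      (\<Sum>x\<in>T. real (degree (delete_verts G S) x))"
    by (intro sum.cong refl) (simp add: degree_def hT cong: sum.cong)
  then have rT: "(\<Sum>x\<in>T. real (r x)) = sum y T + (\<Sum>x\<in>T. real (degree (delete_verts G S) x)) +
      sum h (edges_between G S T)"
    unfolding r_eq sum.distrib sum_incident_edges_split[OF G fin(2) ST(3)] by simp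
  have "(\<Sum>x\<in>S. \<Sum>e\<in>incident_edges (delete_verts G T) x. h e) =
      (\<Sum>x\<in>S. real (degree (delete_verts H T) x))"
    unfolding sum_incident_edges_indicator[OF G H(2), symmetric]
    by (intro sum.cong refl) (rule hS)
  then have rS: "(\<Sum>x\<in>S. real (r x)) = sum y S + (\<Sum>x\<in>S. real (degree (delete_verts H T) x)) +
      sum h (edges_between G S T)"
    unfolding r_eq sum.distrib sum_incident_edges_split[OF G fin(1) ST(4)]
    by (simp add: edges_between_commute)
  have "num_edges_between H T S = num_edges_between H S T"
    using edges_between_commute[of H S T]
    by (simp add: num_edges_between_def edges_between_def)
  \<comment> \<open>The values of \<open>h\<close> on edges between \<open>S\<close> and
    \<open>T\<close> are unknown, but their sum occurs in both \<open>rS\<close> and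
    \<open>rT\<close> and cancels.\<close>
  then have "sum y T \<le> sum y S"
    using cond[OF ST(1-3)] rT rS sum_degree_split[OF H(1) fin(1) ST(4)] by simp
  moreover have "sum y S \<le> 0"
    by (rule sum_nonpos) (simp add: S_def)
  moreover have "0 \<le> sum y T"
    by (rule sum_nonneg) (simp add: T_def)
  \<comment> \<open>The chain 0 \<le> y(T) \<le> y(S) \<le> 0 collapses. The sign is flipped on
    \<open>S\<close> so that a sum of nonnegative terms vanishes.\<close>
  ultimately have "sum y T = 0" "sum (\<lambda>x. - y x) S = 0"
    by (simp_all add: sum_negf)
  moreover have "sum y T = 0 \<longleftrightarrow> (\<forall>x\<in>T. y x = 0)"
    by (rule sum_nonneg_eq_0_iff[OF fin(2)]) (simp add: T_def)
  moreover have "sum (\<lambda>x. - y x) S = 0 \<longleftrightarrow> (\<forall>x\<in>S. - y x = 0)"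
    by (rule sum_nonneg_eq_0_iff[OF fin(1)]) (simp add: S_def)
  ultimately have T0: "\<forall>x\<in>T. y x = 0" and S0: "\<forall>x\<in>S. y x = 0"
    by simp_all
  have y0: "y x = 0" if "x \<in> verts G" for x
  proof -
    have "x \<in> S \<or> x \<in> T \<or> y x = 0"
      using that unfolding S_def T_def by auto
    with T0 S0 show ?thesis
      by blast
  qed
  have "0 \<le> h e \<and> h e \<le> 1" for e
    using h unfolding factor_cube_iff by blast
  then have "fractional_factor G r h"
    unfolding fractional_factor_def using y0 by (auto simp: y_def defect_def)
  then show thesis
    using that h1 by blast
qed

section \<open>Necessity for a single \<open>r\<close>\<close>

text \<open>The splitting used for sufficiency, with inequalities: \<open>h\<close> is at most 1,
  which bounds r(T) above, and at least the indicator of \<open>H\<close>, which bounds r(S) below.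
  The weight between \<open>S\<close> and \<open>T\<close> cancels again.\<close>

lemma fractional_factor_including_bound:
  assumes G: "simple_graph G" and HG: "subgraph_of H G"
    and h: "fractional_factor G r h" "\<forall>e\<in>edges H. h e = 1"
    and ST: "S \<subseteq> verts G" "T \<subseteq> verts G" "S \<inter> T = {}"
  shows "(\<Sum>x\<in>S. real (degree H x)) - real (num_edges_between H S T) \<le>
    (\<Sum>x\<in>S. real (r x)) + (\<Sum>x\<in>T. real (degree (delete_verts G S) x)) - (\<Sum>x\<in>T. real (r x))"
proof -
  have H: "simple_graph H" "edges H \<subseteq> edges G"
    using HG unfolding subgraph_of_def by auto
  have fin: "finite S" "finite T"
    using ST(1,2) G unfolding simple_graph_def by (auto intro: finite_subset)
  have TS: "T \<inter> S = {}"
    using ST(3) by blast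
  have bounds: "0 \<le> h e" "h e \<le> 1" if "e \<in> edges G" for e
    using h(1) that unfolding fractional_factor_def by auto
  have sub: "incident_edges (delete_verts G X) x \<subseteq> edges G" for X x
    unfolding incident_edges_def delete_verts_def by auto
  have r_eq: "(\<Sum>x\<in>X. real (r x)) = (\<Sum>x\<in>X. \<Sum>e\<in>incident_edges G x. h e)"
    if "X \<subseteq> verts G" for X
    using h(1) that unfolding fractional_factor_def by (intro sum.cong) auto
  have "(\<Sum>e\<in>incident_edges (delete_verts G S) x. h e) \<le> real (degree (delete_verts G S) x)" for x
    using sum_bounded_above[of "incident_edges (delete_verts G S) x" h 1] bounds(2) sub
    by (auto simp: degree_def)
  then have T: "(\<Sum>x\<in>T. real (r x)) \<le> (\<Sum>x\<in>T. real (degree (delete_verts G S) x)) +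
      sum h (edges_between G S T)"
    unfolding r_eq[OF ST(2)] sum_incident_edges_split[OF G fin(2) ST(3)] by (simp add: sum_mono)
  have "real (degree (delete_verts H T) x) \<le> (\<Sum>e\<in>incident_edges (delete_verts G T) x. h e)" for x
    unfolding sum_incident_edges_indicator[OF G H(2), symmetric]
    using h(2) bounds(1) sub[of T x] by (intro sum_mono) (auto simp: of_bool_def)
  then have S: "(\<Sum>x\<in>S. real (degree (delete_verts H T) x)) + sum h (edges_between G S T) \<le>
      (\<Sum>x\<in>S. real (r x))"
    unfolding r_eq[OF ST(1)] sum_incident_edges_split[OF G fin(1) TS]
    by (simp add: sum_mono edges_between_commute)
  have "num_edges_between H T S = num_edges_between H S T"
    using edges_between_commute[of H S T]
    by (simp add: num_edges_between_def edges_between_def)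
  then show ?thesis
    using S T sum_degree_split[OF H(1) fin(1) TS] by simp
qed

section \<open>From a single \<open>r\<close> to all \<open>r\<close> between \<open>g\<close> and
  \<open>f\<close>\<close>

theorem theorem4:
  fixes G H :: "'a sgraph" and g f :: "'a \<Rightarrow> nat"
  assumes "simple_graph G"
    and "\<And>x. x \<in> verts G \<Longrightarrow> 0 < g x"
    and "\<And>x. x \<in> verts G \<Longrightarrow> 0 < f x"
    and "\<And>x. x \<in> verts G \<Longrightarrow> g x \<le> f x"
    and "subgraph_of H G"
  shows "all_fractional_factors_including G g f H \<longleftrightarrow>
    (\<forall>S T. S \<subseteq> verts G \<and> T \<subseteq> verts G \<and> S \<inter> T = {} \<longrightarrow>
      int (\<Sum>x\<in>S. g x) + int (\<Sum>x\<in>T. degree (delete_verts G S) x) - int (\<Sum>x\<in>T. f x)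
        \<ge> int (\<Sum>x\<in>S. degree H x) - int (num_edges_between H S T))"
    (is "_ \<longleftrightarrow> (\<forall>S T. ?disj S T \<longrightarrow> ?cond S T)")
proof -
  \<comment> \<open>The condition is stated over the integers, whereas the bounds on
    \<open>h\<close> are real.\<close>
  have cond_real: "?cond S T \<longleftrightarrow>
      (\<Sum>x\<in>S. real (degree H x)) - real (num_edges_between H S T) \<le>
      (\<Sum>x\<in>S. real (g x)) + (\<Sum>x\<in>T. real (degree (delete_verts G S) x)) - (\<Sum>x\<in>T. real (f x))"
    for S T
    unfolding of_nat_sum[where ?'a = real, symmetric] by linarith
  show ?thesis
  proof (intro iffI allI impI)
    fix S T
    assume all: "all_fractional_factors_including G g f H" and ST: "?disj S T"
    \<comment> \<open>The extremal choice: r(S) is least and r(T) is greatest at once, as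
      \<open>S\<close> and \<open>T\<close> are disjoint.\<close>
    define r where "r x = (if x \<in> S then g x else f x)" for x
    have "\<forall>x\<in>verts G. g x \<le> r x \<and> r x \<le> f x"
      using assms(4) unfolding r_def by auto
    then obtain h where h: "fractional_factor G r h" "\<forall>e\<in>edges H. h e = 1"
      using all unfolding all_fractional_factors_including_def by blast
    have "(\<Sum>x\<in>S. real (r x)) = (\<Sum>x\<in>S. real (g x))"
      unfolding r_def by (rule sum.cong) auto
    moreover have "(\<Sum>x\<in>T. real (r x)) = (\<Sum>x\<in>T. real (f x))"
      using ST unfolding r_def by (intro sum.cong) auto
    ultimately show "?cond S T"
      using fractional_factor_including_bound[OF assms(1,5) h, of S T] ST
      unfolding cond_real by simp
  next
    assume cond: "\<forall>S T. ?disj S T \<longrightarrow> ?cond S T"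
    show "all_fractional_factors_including G g f H"
      unfolding all_fractional_factors_including_def
    proof (intro allI impI)
      fix r :: "'a \<Rightarrow> nat"
      assume r: "\<forall>x\<in>verts G. g x \<le> r x \<and> r x \<le> f x"
      show "\<exists>h. fractional_factor G r h \<and> (\<forall>e\<in>edges H. h e = 1)"
      proof (rule fractional_factor_including_exists[OF assms(1,5), of r])
        fix S T
        assume ST: "S \<subseteq> verts G" "T \<subseteq> verts G" "S \<inter> T = {}"
        \<comment> \<open>Passing from \<open>g\<close> on \<open>S\<close> and \<open>f\<close> on
          \<open>T\<close> to \<open>r\<close> can only increase g(S) + d_{G-S}(T) - f(T), so the
          condition carries over to \<open>r\<close>.\<close>
        have "(\<Sum>x\<in>S. real (g x)) \<le> (\<Sum>x\<in>S. real (r x))"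
          using r ST by (intro sum_mono) auto
        moreover have "(\<Sum>x\<in>T. real (r x)) \<le> (\<Sum>x\<in>T. real (f x))"
          using r ST by (intro sum_mono) auto
        ultimately show "(\<Sum>x\<in>S. real (degree H x)) - real (num_edges_between H S T) \<le>
            (\<Sum>x\<in>S. real (r x)) + (\<Sum>x\<in>T. real (degree (delete_verts G S) x)) -
            (\<Sum>x\<in>T. real (r x))"
          using cond[rule_format, of S T] ST unfolding cond_real by simp
      qed blast
    qed
  qed
qed

end
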